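(* Let the system be affected by anomalies at both the input and output stages, so that $Y_t=h_0(X_t+\delta_t)+\epsilon_t$ for all $t\in\mathbb{Z}$, and let the baseline function $h_0:\mathbb{R}\to\mathbb{R}$ be Lipschitz continuous. Let the inputs $X_t$ be strictly stationary, $\alpha$-mixing, and have finite $p$-th moments $\mathbb{E}(|X_t|^p)<\infty$ for some $p>1$. Then the outputs $Y_t$ are out of $p$-reasonable order with respect to the inputs whenever the following conditions hold: (i) the input anomalies $\delta_t$ are iid, the output anomalies $\epsilon_t$ are also iid, they are independent of each other, and are also independent of the inputs $X_t$; (ii) $\mathbb{E}\big(|h_0(X_1+\delta_2)+\epsilon_2-h_0(X_1+\delta_1)-\epsilon_1|\big)>0$.
   Context: The inputs $(X_t)_{t\in\mathbb{Z}}$ are real-valued random variables with the same continuous marginal cdf, assumed (almost surely) pairwise distinct, so the order statistics of $X_1,\dots,X_n$ satisfy $X_{1:n}<\cdots<X_{n:n}$. The input anomalies $(\delta_t)_{t\in\mathbb{Z}}$ and output anomalies $(\epsilon_t)_{t\in\mathbb{Z}}$ are real-valued random variables; condition (i) means that the three sequences $(X_t)$, $(\delta_t)$, $(\epsilon_t)$ are mutually independent and that each of $(\delta_t)$ and $(\epsilon_t)$ is iid. A strictly stationary sequence $X_t$ is $\alpha$-mixing if $\alpha_X(t):=\sup|\mathbb{P}(A\cap B)-\mathbb{P}(A)\mathbb{P}(B)|\to 0$ when $t\to\infty$, where the supremum is over all $A\in\sigma(X_u,\,u\le 0)$ and $B\in\sigma(X_v,\,v\ge t)$. The concomitants of the outputs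 with respect to the inputs are $Y_{t,n}=\sum_{s=1}^n Y_s\mathbf{1}\{X_s=X_{t:n}\}$, $t=1,\dots,n$. The outputs are out of $p$-reasonable order with respect to the inputs if $B_{n,p}:=n^{-1/p}\sum_{t=2}^n|Y_{t,n}-Y_{t-1,n}|\to_{\mathbb{P}}\infty$ when $n\to\infty$, meaning $\mathbb{P}(B_{n,p}\le\lambda)\to 0$ for every $\lambda<\infty$. *)

theory Defs
  imports "HOL-Probability.Probability"
begin

definition finite_dim_law :: "'a measure \<Rightarrow> (int \<Rightarrow> 'a \<Rightarrow> real) \<Rightarrow> int set \<Rightarrow> (int \<Rightarrow> real) measure" where
  "finite_dim_law M X J = distr M (Pi\<^sub>M J (\<lambda>_. borel)) (\<lambda>\<omega>. \<lambda>t\<in>J. X t \<omega>)"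

definition strictly_stationary :: "'a measure \<Rightarrow> (int \<Rightarrow> 'a \<Rightarrow> real) \<Rightarrow> bool" where
  "strictly_stationary M X \<longleftrightarrow>
     (\<forall>J k. finite J \<longrightarrow> finite_dim_law M (\<lambda>t. X (t + k)) J = finite_dim_law M X J)"

text \<open>The events of the sigma-algebra generated by the variables \<open>X u\<close>, \<open>u \<in> I\<close>.\<close>

definition generated_events :: "'a measure \<Rightarrow> (int \<Rightarrow> 'a \<Rightarrow> real) \<Rightarrow> int set \<Rightarrow> 'a set set" where
  "generated_events M X I =
     sigma_sets (space M) {X u -` S \<inter> space M | u S. u \<in> I \<and> S \<in> sets borel}"

text \<open>For a probability measure the supremum is over a nonempty set of reals bounded by 1.\<close>

definition alpha_coeff :: "'a measure \<Rightarrow> (int \<Rightarrow> 'a \<Rightarrow> real) \<Rightarrow> nat \<Rightarrow> real" where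
  "alpha_coeff M X t =
     (SUP (A, B) \<in> generated_events M X {..0} \<times> generated_events M X {int t..}.
        \<bar>measure M (A \<inter> B) - measure M A * measure M B\<bar>)"

definition alpha_mixing :: "'a measure \<Rightarrow> (int \<Rightarrow> 'a \<Rightarrow> real) \<Rightarrow> bool" where
  "alpha_mixing M X \<longleftrightarrow> alpha_coeff M X \<longlonglongrightarrow> 0"

definition iid :: "'a measure \<Rightarrow> (int \<Rightarrow> 'a \<Rightarrow> real) \<Rightarrow> bool" where
  "iid M Z \<longleftrightarrow> prob_space.indep_vars M (\<lambda>_. borel) Z UNIV \<and>
     (\<forall>s t. distr M borel (Z s) = distr M borel (Z t))"

text \<open>Mutual independence of three sequences, each regarded as one random element of the
  product space of all real sequences indexed by the integers.\<close>

definition indep_sequences ::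
  "'a measure \<Rightarrow> (int \<Rightarrow> 'a \<Rightarrow> real) \<Rightarrow> (int \<Rightarrow> 'a \<Rightarrow> real) \<Rightarrow> (int \<Rightarrow> 'a \<Rightarrow> real) \<Rightarrow> bool" where
  "indep_sequences M X \<delta> \<epsilon> \<longleftrightarrow>
     prob_space.indep_vars M (\<lambda>_. Pi\<^sub>M UNIV (\<lambda>_. borel)) (\<lambda>i \<omega> t. ([X, \<delta>, \<epsilon>] ! i) t \<omega>) {..<3::nat}"

text \<open>The \<open>t\<close>-th smallest of \<open>x 1, \<dots>, x n\<close>, for \<open>1 \<le> t \<le> n\<close>.\<close>

definition order_stat :: "(int \<Rightarrow> real) \<Rightarrow> nat \<Rightarrow> nat \<Rightarrow> real" where
  "order_stat x n t = sort (map x [1..int n]) ! (t - 1)"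

definition concomitant :: "(int \<Rightarrow> real) \<Rightarrow> (int \<Rightarrow> real) \<Rightarrow> nat \<Rightarrow> nat \<Rightarrow> real" where
  "concomitant x y n t = (\<Sum>s = 1..int n. y s * of_bool (x s = order_stat x n t))"

definition B_stat :: "real \<Rightarrow> (int \<Rightarrow> real) \<Rightarrow> (int \<Rightarrow> real) \<Rightarrow> nat \<Rightarrow> real" where
  "B_stat p x y n =
     real n powr (- 1 / p) * (\<Sum>t = 2..n. \<bar>concomitant x y n t - concomitant x y n (t - 1)\<bar>)"

text \<open>Intended for sequences \<open>X\<close>, \<open>Y\<close> of random variables, for which the sets below are events.\<close>

definition out_of_reasonable_order ::
  "'a measure \<Rightarrow> real \<Rightarrow> (int \<Rightarrow> 'a \<Rightarrow> real) \<Rightarrow> (int \<Rightarrow> 'a \<Rightarrow> real) \<Rightarrow> bool" where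
  "out_of_reasonable_order M p X Y \<longleftrightarrow>
     (\<forall>c::real. (\<lambda>n. measure M {\<omega> \<in> space M. B_stat p (\<lambda>s. X s \<omega>) (\<lambda>s. Y s \<omega>) n \<le> c})
        \<longlonglongrightarrow> 0)"

end

theory Submission
  imports Defs
begin

text \<open>Condition on the inputs. Sorting them amounts to a fixed permutation, and by the Lipschitz property
  \<open>\<Sum>\<bar>Y\<^bsub>t,n\<^esub> - Y\<^bsub>t-1,n\<^esub>\<bar>\<close> changes by at most a multiple of the range of the inputs when the input of
  \<open>Y\<^bsub>t,n\<^esub>\<close> is replaced by that of \<open>Y\<^bsub>t-1,n\<^esub>\<close>. After truncation at 1 the new sum is a sum of bounded
  1-dependent variables, so by Chebyshev's inequality it is within \<open>o(n)\<close> of \<open>\<Sum> g(X\<^sub>s)\<close>, where \<open>g(x)\<close> is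
  the mean truncated difference of two outputs with the same input \<open>x\<close>. Condition (ii) gives \<open>g \<ge> c\<close> on
  a set that \<open>X\<^sub>1\<close> hits with positive probability; covariances of its indicators are bounded by the mixing
  coefficients, so the fraction of inputs in this set converges in probability and \<open>\<Sum> g(X\<^sub>s)\<close> grows
  linearly. By Markov's inequality the range of the inputs is \<open>o(n)\<close>, and \<open>n\<close> dominates \<open>n\<^bsup>1/p\<^esup>\<close> because
  \<open>p > 1\<close>.\<close>

section \<open>Order statistics and concomitants\<close>

text \<open>Extensionality makes the arranging permutation unique.\<close>

definition arranges :: "(nat \<Rightarrow> int) \<Rightarrow> (int \<Rightarrow> real) \<Rightarrow> nat \<Rightarrow> bool" where
  "arranges \<sigma> x n \<longleftrightarrow> \<sigma> \<in> {1..n} \<rightarrow>\<^sub>E {1..int n} \<and>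
     (\<forall>i\<in>{1..n}. \<forall>j\<in>{1..n}. i < j \<longrightarrow> x (\<sigma> i) < x (\<sigma> j))"

lemma arranges_less:
  "arranges \<sigma> x n \<Longrightarrow> 1 \<le> i \<Longrightarrow> i < j \<Longrightarrow> j \<le> n \<Longrightarrow> x (\<sigma> i) < x (\<sigma> j)"
  by (simp add: arranges_def)

lemma arranges_inj_on: "arranges \<sigma> x n \<Longrightarrow> inj_on \<sigma> {1..n}"
  unfolding arranges_def by (intro linorder_inj_onI) (force simp: less_le)+

lemma arranges_bij_betw:
  assumes "arranges \<sigma> x n"
  shows "bij_betw \<sigma> {1..n} {1..int n}"
proof -
  have "\<sigma> ` {1..n} \<subseteq> {1..int n}" using assms by (auto simp: arranges_def)
  moreover have "card (\<sigma> ` {1..n}) = card {1..int n}"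
    using card_image[OF arranges_inj_on[OF assms]] by simp
  ultimately show ?thesis
    using arranges_inj_on[OF assms] card_subset_eq[of "{1..int n}" "\<sigma> ` {1..n}"]
    by (simp add: bij_betw_def)
qed

text \<open>The values of \<open>x\<close> along \<open>\<sigma>\<close> form a strictly increasing
  list with the same entries as the sample. Its length forces \<open>x\<close> to be injective on
  the sample, so this list must be the sorted sample.\<close>

lemma arranges_order_stat:
  assumes "arranges \<sigma> x n" "t \<in> {1..n}"
  shows "order_stat x n t = x (\<sigma> t)"
proof -
  define xs where "xs = map (\<lambda>i. x (\<sigma> (Suc i))) [0..<n]"
  have strict: "sorted_wrt (<) xs"
    using assms(1) by (auto simp: xs_def sorted_wrt_iff_nth_less arranges_def)
  have "x ` \<sigma> ` {1..n} = x ` {1..int n}"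
    using arranges_bij_betw[OF assms(1)] by (simp add: bij_betw_def)
  then have img: "(x \<circ> \<sigma>) ` {1..n} = x ` {1..int n}"
    by (simp add: image_comp)
  have "(\<lambda>i. x (\<sigma> (Suc i))) ` {0..<n} = (x \<circ> \<sigma>) ` Suc ` {0..<n}"
    by (simp only: image_image o_def)
  then have set: "set xs = x ` {1..int n}"
    using img by (simp add: xs_def image_Suc_atLeastLessThan atLeastLessThanSuc_atLeastAtMost
      del: image_Suc_lessThan)
  then have "card (x ` {1..int n}) = length xs"
    using strict_sorted_iff[of xs] strict distinct_card[of xs] by simp
  then have "inj_on x {1..int n}"
    by (intro eq_card_imp_inj_on) (auto simp: xs_def)
  then have "distinct (map x [1..int n])" by (simp add: distinct_map)
  then have "sort (map x [1..int n]) = xs"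
    using strict set by (intro sorted_distinct_set_unique) (auto simp: strict_sorted_iff)
  then show ?thesis
    using assms(2) by (auto simp: order_stat_def xs_def)
qed

text \<open>The values along \<open>\<sigma>\<close> are distinct, so the defining sum has a single
  nonzero term. From here on sorting is nothing but reindexing by \<open>\<sigma>\<close>.\<close>

lemma arranges_concomitant:
  assumes "arranges \<sigma> x n" "t \<in> {1..n}"
  shows "concomitant x y n t = y (\<sigma> t)"
proof -
  note bij = arranges_bij_betw[OF assms(1)]
  have eq: "x (\<sigma> i) = x (\<sigma> t) \<longleftrightarrow> i = t" if "i \<in> {1..n}" for i
    using assms that unfolding arranges_def by (metis less_irrefl linorder_neqE_nat)
  have "concomitant x y n t = (\<Sum>s = 1..int n. y s * of_bool (x s = x (\<sigma> t)))"
    by (simp add: concomitant_def arranges_order_stat[OF assms])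
  also have "\<dots> = (\<Sum>i = 1..n. y (\<sigma> i) * of_bool (x (\<sigma> i) = x (\<sigma> t)))"
    by (rule sum.reindex_bij_betw[OF bij, symmetric])
  also have "\<dots> = (\<Sum>i = 1..n. if i = t then y (\<sigma> i) else 0)"
    by (intro sum.cong) (auto simp: eq)
  finally show ?thesis using assms(2) by simp
qed

text \<open>Concomitants are defined without reference to a permutation. With the indices themselves
  as outputs, they spell out \<open>\<sigma>\<close>.\<close>

lemma arranges_unique:
  assumes "arranges \<sigma> x n" "arranges \<tau> x n"
  shows "\<sigma> = \<tau>"
proof (rule PiE_ext)
  show "\<sigma> \<in> {1..n} \<rightarrow>\<^sub>E {1..int n}" "\<tau> \<in> {1..n} \<rightarrow>\<^sub>E {1..int n}"
    using assms by (simp_all add: arranges_def)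
  fix t assume "t \<in> {1..n}"
  then show "\<sigma> t = \<tau> t"
    using arranges_concomitant[OF assms(1), of t of_int] arranges_concomitant[OF assms(2), of t of_int]
    by simp
qed

lemma arranges_exists:
  assumes "inj_on x {1..int n}"
  shows "\<exists>\<sigma>. arranges \<sigma> x n"
proof -
  define xs where "xs = sort (map x [1..int n])"
  define \<sigma> where "\<sigma> = (\<lambda>t\<in>{1..n}. the_inv_into {1..int n} x (xs ! (t - 1)))"
  have len: "length xs = n" and set: "set xs = x ` {1..int n}"
    by (simp_all add: xs_def)
  have mem: "xs ! (t - 1) \<in> x ` {1..int n}" if "t \<in> {1..n}" for t
    unfolding set[symmetric] using that len by (intro nth_mem) auto
  have x\<sigma>: "x (\<sigma> t) = xs ! (t - 1)" if "t \<in> {1..n}" for t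
    using f_the_inv_into_f[OF assms mem[OF that]] that by (simp add: \<sigma>_def)
  have strict: "sorted_wrt (<) xs"
    using assms by (simp add: xs_def strict_sorted_iff distinct_map)
  have "\<sigma> \<in> {1..n} \<rightarrow>\<^sub>E {1..int n}"
    using the_inv_into_into[OF assms mem, of _ "{1..int n}"] by (auto simp: \<sigma>_def)
  moreover have "x (\<sigma> i) < x (\<sigma> j)" if "i \<in> {1..n}" "j \<in> {1..n}" "i < j" for i j
    using sorted_wrt_nth_less[OF strict, of "i - 1" "j - 1"] that len by (auto simp: x\<sigma>)
  ultimately show ?thesis unfolding arranges_def by blast
qed

lemma arranges_B_stat:
  assumes "arranges \<sigma> x n"
  shows "B_stat p x y n = real n powr (- 1 / p) * (\<Sum>t = 2..n. \<bar>y (\<sigma> t) - y (\<sigma> (t - 1))\<bar>)"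
  unfolding B_stat_def
proof (intro arg_cong2[where f = "(*)"] refl sum.cong)
  fix t assume "t \<in> {2..n}"
  then have "t \<in> {1..n}" "t - 1 \<in> {1..n}" by auto
  then show "\<bar>concomitant x y n t - concomitant x y n (t - 1)\<bar> = \<bar>y (\<sigma> t) - y (\<sigma> (t - 1))\<bar>"
    by (simp only: arranges_concomitant[OF assms])
qed

text \<open>Truncation at 1 makes second moments available; freezing the input at its left neighbour
  costs at most the Lipschitz constant times the range of the inputs.\<close>

definition anomaly_gap :: "(real \<Rightarrow> real) \<Rightarrow> real \<Rightarrow> real \<times> real \<Rightarrow> real \<times> real \<Rightarrow> real" where
  "anomaly_gap h x v w = min 1 \<bar>(h (x + fst v) + snd v) - (h (x + fst w) + snd w)\<bar>"

lemma sum_anomaly_gap_le: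
  fixes x :: "int \<Rightarrow> real" and w :: "int \<Rightarrow> real \<times> real"
  assumes ord: "arranges \<sigma> x n" and lip: "L-lipschitz_on UNIV h"
    and bound: "\<And>s. s \<in> {1..int n} \<Longrightarrow> \<bar>x s\<bar> \<le> R"
    and y: "\<And>s. y s = h (x s + fst (w s)) + snd (w s)"
    and "0 < n"
  shows "(\<Sum>t = 2..n. anomaly_gap h (x (\<sigma> (t - 1))) (w (\<sigma> t)) (w (\<sigma> (t - 1))))
    \<le> real n powr (1 / p) * B_stat p x y n + 2 * L * R"
proof -
  have L: "0 \<le> L" using lip by (rule lipschitz_on_nonneg)
  have step: "anomaly_gap h (x (\<sigma> (t - 1))) (w (\<sigma> t)) (w (\<sigma> (t - 1)))
      \<le> \<bar>y (\<sigma> t) - y (\<sigma> (t - 1))\<bar> + L * (x (\<sigma> t) - x (\<sigma> (t - 1)))" if "t \<in> {2..n}" for t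
  proof -
    have "x (\<sigma> (t - 1)) < x (\<sigma> t)"
      using that by (intro arranges_less[OF ord]) auto
    moreover have "\<bar>h (x (\<sigma> t) + fst (w (\<sigma> t))) - h (x (\<sigma> (t - 1)) + fst (w (\<sigma> t)))\<bar>
        \<le> L * \<bar>x (\<sigma> t) - x (\<sigma> (t - 1))\<bar>"
      using lipschitz_onD[OF lip, of "x (\<sigma> t) + fst (w (\<sigma> t))" "x (\<sigma> (t - 1)) + fst (w (\<sigma> t))"]
      by (simp add: dist_real_def)
    ultimately show ?thesis
      unfolding anomaly_gap_def y by (smt (verit))
  qed
  \<comment> \<open>Increments along the sorted order are positive, so the Lipschitz errors
    telescope to the range of the inputs.\<close>
  have "(\<Sum>t = 2..n. x (\<sigma> t) - x (\<sigma> (t - 1))) = x (\<sigma> n) - x (\<sigma> 1)"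
    using sum_telescope''[of 1 n "\<lambda>t. x (\<sigma> t)"] \<open>0 < n\<close> by (simp add: numeral_2_eq_2)
  also have "\<dots> \<le> 2 * R"
  proof -
    have "\<sigma> n \<in> {1..int n}" "\<sigma> 1 \<in> {1..int n}"
      using ord \<open>0 < n\<close> by (auto simp: arranges_def PiE_iff)
    from bound[OF this(1)] bound[OF this(2)] show ?thesis by linarith
  qed
  finally have range: "L * (\<Sum>t = 2..n. x (\<sigma> t) - x (\<sigma> (t - 1))) \<le> L * (2 * R)"
    using L by (rule mult_left_mono)
  have "real n powr (1 / p) * real n powr (- 1 / p) = 1"
    using \<open>0 < n\<close> by (simp flip: powr_add)
  then have B: "real n powr (1 / p) * B_stat p x y n = (\<Sum>t = 2..n. \<bar>y (\<sigma> t) - y (\<sigma> (t - 1))\<bar>)"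
    by (simp add: arranges_B_stat[OF ord] flip: mult.assoc)
  have "(\<Sum>t = 2..n. anomaly_gap h (x (\<sigma> (t - 1))) (w (\<sigma> t)) (w (\<sigma> (t - 1))))
      \<le> (\<Sum>t = 2..n. \<bar>y (\<sigma> t) - y (\<sigma> (t - 1))\<bar> + L * (x (\<sigma> t) - x (\<sigma> (t - 1))))"
    by (intro sum_mono step)
  then show ?thesis
    using range by (simp add: B sum.distrib flip: sum_distrib_left)
qed

lemma anomaly_gap_bounds: "0 \<le> anomaly_gap h x v w" "anomaly_gap h x v w \<le> 1"
  by (simp_all add: anomaly_gap_def)

lemma measurable_anomaly_gap [measurable (raw)]:
  assumes [measurable]: "h \<in> borel_measurable borel" "f \<in> borel_measurable N"
    "v \<in> borel_measurable N" "w \<in> borel_measurable N"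
  shows "(\<lambda>z. anomaly_gap h (f z) (v z) (w z)) \<in> borel_measurable N"
proof -
  have [measurable]: "(\<lambda>z. fst (u z)) \<in> borel_measurable N" "(\<lambda>z. snd (u z)) \<in> borel_measurable N"
    if "u \<in> borel_measurable N" for u :: "'a \<Rightarrow> real \<times> real"
    using that by (auto simp: borel_prod[symmetric] intro: measurable_compose[OF _ measurable_fst] measurable_compose[OF _ measurable_snd])
  show ?thesis unfolding anomaly_gap_def by measurable
qed

text \<open>The deterministic core: a small \<open>B_stat\<close> keeps the sum of the gaps small,
  whereas \<open>m\<close> visits to the set where \<open>g\<close> is at least \<open>c\<close>
  make the sum of \<open>g\<close> large, so the two sums lie far apart. In the application
  \<open>m\<close> and \<open>R\<close> are multiples of \<open>n\<close>.\<close>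

lemma sum_anomaly_gap_deviation:
  fixes x :: "int \<Rightarrow> real" and w :: "int \<Rightarrow> real \<times> real" and g :: "real \<Rightarrow> real"
  assumes ord: "arranges \<sigma> x n" and lip: "L-lipschitz_on UNIV h"
    and bound: "\<And>s. s \<in> {1..int n} \<Longrightarrow> \<bar>x s\<bar> \<le> R"
    and y: "\<And>s. y s = h (x s + fst (w s)) + snd (w s)"
    and "0 < n" and B: "B_stat p x y n \<le> b"
    and g: "\<And>z. 0 \<le> g z" "\<And>z. g z \<le> 1"
    and c: "0 \<le> c" and m: "m \<le> (\<Sum>s = 1..int n. indicator {z. c \<le> g z} (x s))"
  shows "c * m - 1 - \<bar>b\<bar> * real n powr (1 / p) - 2 * L * R
    \<le> \<bar>\<Sum>t = 2..n. anomaly_gap h (x (\<sigma> (t - 1))) (w (\<sigma> t)) (w (\<sigma> (t - 1))) - g (x (\<sigma> (t - 1)))\<bar>"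
proof -
  have "c * m \<le> (\<Sum>s = 1..int n. c * indicator {z. c \<le> g z} (x s))"
    using mult_left_mono[OF m c] by (simp add: sum_distrib_left)
  also have "\<dots> \<le> (\<Sum>s = 1..int n. g (x s))"
    using g by (intro sum_mono) (auto split: split_indicator)
  also have "\<dots> = (\<Sum>t = 1..n. g (x (\<sigma> t)))"
    by (rule sum.reindex_bij_betw[OF arranges_bij_betw[OF ord], symmetric])
  \<comment> \<open>Left neighbours have ranks 1 to \<open>n - 1\<close>; the missing top rank costs
    the 1 in the bound.\<close>
  also have "\<dots> = (\<Sum>t = 2..n. g (x (\<sigma> (t - 1)))) + g (x (\<sigma> n))"
    using \<open>0 < n\<close> by (induction n rule: nat_induct_non_zero) simp_all
  also have "\<dots> \<le> (\<Sum>t = 2..n. g (x (\<sigma> (t - 1)))) + 1"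
    using g by simp
  finally have g_sum: "c * m - 1 \<le> (\<Sum>t = 2..n. g (x (\<sigma> (t - 1))))" by simp
  have "real n powr (1 / p) * B_stat p x y n \<le> real n powr (1 / p) * \<bar>b\<bar>"
    using B by (intro mult_left_mono) auto
  with sum_anomaly_gap_le[OF ord lip bound y \<open>0 < n\<close>, of p] g_sum
  show ?thesis by (simp add: sum_subtractf mult.commute)
qed

section \<open>Independence and second moments\<close>

text \<open>The library's \<open>indep_var\<close> requires both variables to have the same type; for variables of
  different types independence is expressed by the joint law.\<close>

lemma (in prob_space) distr_Pair_compose:
  assumes ind: "indep_var S X T Y" and f: "f \<in> measurable S S'" and g: "g \<in> measurable T T'"
  shows "distr M (S' \<Otimes>\<^sub>M T') (\<lambda>\<omega>. (f (X \<omega>), g (Y \<omega>)))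
    = distr M S' (\<lambda>\<omega>. f (X \<omega>)) \<Otimes>\<^sub>M distr M T' (\<lambda>\<omega>. g (Y \<omega>))"
proof -
  have X[measurable]: "X \<in> measurable M S" and Y[measurable]: "Y \<in> measurable M T"
    using indep_var_rv1[OF ind] indep_var_rv2[OF ind] by simp_all
  note f[measurable] g[measurable]
  interpret X: prob_space "distr M S X" by (rule prob_space_distr) (rule X)
  interpret Y: prob_space "distr M T Y" by (rule prob_space_distr) (rule Y)
  interpret gY: prob_space "distr (distr M T Y) T' g" by (rule Y.prob_space_distr) simp
  have "distr M (S' \<Otimes>\<^sub>M T') (\<lambda>\<omega>. (f (X \<omega>), g (Y \<omega>)))
      = distr (distr M (S \<Otimes>\<^sub>M T) (\<lambda>\<omega>. (X \<omega>, Y \<omega>))) (S' \<Otimes>\<^sub>M T') (\<lambda>(x, y). (f x, g y))"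
    by (subst distr_distr) (auto simp: o_def)
  also have "\<dots> = distr (distr M S X \<Otimes>\<^sub>M distr M T Y) (S' \<Otimes>\<^sub>M T') (\<lambda>(x, y). (f x, g y))"
    using ind unfolding indep_var_distribution_eq by simp
  also have "\<dots> = distr (distr M S X) S' f \<Otimes>\<^sub>M distr (distr M T Y) T' g"
    by (rule pair_measure_distr[symmetric]) (auto intro: gY.sigma_finite_measure_axioms)
  finally show ?thesis by (simp add: distr_distr o_def)
qed

text \<open>Tonelli's theorem for the product law: \<open>\<omega>'\<close> acts as an independent
  copy of the sample point, and the first variable is frozen in the inner integral.\<close>

lemma (in prob_space) nn_integral_indep_var:
  assumes X[measurable]: "X \<in> measurable M S" and Y[measurable]: "Y \<in> measurable M T"
    and law: "distr M (S \<Otimes>\<^sub>M T) (\<lambda>\<omega>. (X \<omega>, Y \<omega>)) = distr M S X \<Otimes>\<^sub>M distr M T Y"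
    and F[measurable]: "F \<in> borel_measurable (S \<Otimes>\<^sub>M T)"
  shows "(\<integral>\<^sup>+\<omega>. F (X \<omega>, Y \<omega>) \<partial>M) = (\<integral>\<^sup>+\<omega>. \<integral>\<^sup>+\<omega>'. F (X \<omega>, Y \<omega>') \<partial>M \<partial>M)"
proof -
  interpret Y: prob_space "distr M T Y" by (rule prob_space_distr) (rule Y)
  have "(\<integral>\<^sup>+\<omega>. F (X \<omega>, Y \<omega>) \<partial>M) = (\<integral>\<^sup>+z. F z \<partial>distr M (S \<Otimes>\<^sub>M T) (\<lambda>\<omega>. (X \<omega>, Y \<omega>)))"
    by (subst nn_integral_distr) auto
  also have "\<dots> = (\<integral>\<^sup>+x. \<integral>\<^sup>+y. F (x, y) \<partial>distr M T Y \<partial>distr M S X)"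
    unfolding law by (rule Y.nn_integral_fst[symmetric]) simp
  also have "\<dots> = (\<integral>\<^sup>+\<omega>. \<integral>\<^sup>+y. F (X \<omega>, y) \<partial>distr M T Y \<partial>M)"
    by (subst nn_integral_distr) auto
  also have "\<dots> = (\<integral>\<^sup>+\<omega>. \<integral>\<^sup>+\<omega>'. F (X \<omega>, Y \<omega>') \<partial>M \<partial>M)"
  proof (rule nn_integral_cong)
    fix \<omega> assume "\<omega> \<in> space M"
    then have [measurable]: "(\<lambda>y. F (X \<omega>, y)) \<in> borel_measurable T"
      using measurable_space[OF X] by (intro measurable_compose[OF _ F]) auto
    show "(\<integral>\<^sup>+y. F (X \<omega>, y) \<partial>distr M T Y) = (\<integral>\<^sup>+\<omega>'. F (X \<omega>, Y \<omega>') \<partial>M)"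
      by (subst nn_integral_distr) auto
  qed
  finally show ?thesis .
qed

lemma (in prob_space) prob_indep_var_le:
  assumes X[measurable]: "X \<in> measurable M S" and Y[measurable]: "Y \<in> measurable M T"
    and law: "distr M (S \<Otimes>\<^sub>M T) (\<lambda>\<omega>. (X \<omega>, Y \<omega>)) = distr M S X \<Otimes>\<^sub>M distr M T Y"
    and H[measurable]: "H \<in> sets (S \<Otimes>\<^sub>M T)" and b: "0 \<le> b"
    and sections: "\<And>x. x \<in> space S \<Longrightarrow> prob {\<omega> \<in> space M. (x, Y \<omega>) \<in> H} \<le> b"
  shows "prob {\<omega> \<in> space M. (X \<omega>, Y \<omega>) \<in> H} \<le> b"
proof -
  have emeasure_eq: "emeasure M {\<omega> \<in> space M. Z \<omega> \<in> H} = (\<integral>\<^sup>+\<omega>. indicator H (Z \<omega>) \<partial>M)"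
    if [measurable]: "Z \<in> measurable M (S \<Otimes>\<^sub>M T)" for Z
  proof -
    have "emeasure M {\<omega> \<in> space M. Z \<omega> \<in> H} = (\<integral>\<^sup>+\<omega>. indicator {\<omega> \<in> space M. Z \<omega> \<in> H} \<omega> \<partial>M)"
      by (rule nn_integral_indicator[symmetric]) simp
    also have "\<dots> = (\<integral>\<^sup>+\<omega>. indicator H (Z \<omega>) \<partial>M)"
      by (intro nn_integral_cong) (auto split: split_indicator)
    finally show ?thesis .
  qed
  have "emeasure M {\<omega> \<in> space M. (X \<omega>, Y \<omega>) \<in> H} = (\<integral>\<^sup>+\<omega>. indicator H (X \<omega>, Y \<omega>) \<partial>M)"
    by (rule emeasure_eq) simp
  also have "\<dots> = (\<integral>\<^sup>+\<omega>. \<integral>\<^sup>+\<omega>'. indicator H (X \<omega>, Y \<omega>') \<partial>M \<partial>M)"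
    by (rule nn_integral_indep_var[OF X Y law]) simp
  also have "\<dots> \<le> (\<integral>\<^sup>+\<omega>. ennreal b \<partial>M)"
  proof (rule nn_integral_mono)
    fix \<omega> assume "\<omega> \<in> space M"
    then have x: "X \<omega> \<in> space S" using measurable_space[OF X] by blast
    have [measurable]: "(\<lambda>\<omega>'. (X \<omega>, Y \<omega>')) \<in> measurable M (S \<Otimes>\<^sub>M T)"
      using x by simp
    have "(\<integral>\<^sup>+\<omega>'. indicator H (X \<omega>, Y \<omega>') \<partial>M) = emeasure M {\<omega>' \<in> space M. (X \<omega>, Y \<omega>') \<in> H}"
      by (rule emeasure_eq[symmetric]) simp
    also have "\<dots> \<le> ennreal b"
      using sections[OF x] by (simp add: emeasure_eq_measure ennreal_leI)
    finally show "(\<integral>\<^sup>+\<omega>'. indicator H (X \<omega>, Y \<omega>') \<partial>M) \<le> ennreal b" .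
  qed
  also have "\<dots> = ennreal b" by (simp add: emeasure_space_1)
  finally show ?thesis using b by (simp add: emeasure_eq_measure)
qed

section \<open>Second moments of weakly dependent sums\<close>

lemma (in prob_space) expectation_sum_square_le:
  fixes V :: "'i \<Rightarrow> 'a \<Rightarrow> real"
  assumes J: "finite J" and V: "\<And>i. i \<in> J \<Longrightarrow> V i \<in> borel_measurable M"
    and bound: "\<And>i \<omega>. i \<in> J \<Longrightarrow> \<omega> \<in> space M \<Longrightarrow> \<bar>V i \<omega>\<bar> \<le> 1"
    and corr: "\<And>i j. i \<in> J \<Longrightarrow> j \<in> J \<Longrightarrow> expectation (\<lambda>\<omega>. V i \<omega> * V j \<omega>) \<le> r i j"
  shows "integrable M (\<lambda>\<omega>. (\<Sum>i\<in>J. V i \<omega>)\<^sup>2)"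
    and "expectation (\<lambda>\<omega>. (\<Sum>i\<in>J. V i \<omega>)\<^sup>2) \<le> (\<Sum>i\<in>J. \<Sum>j\<in>J. r i j)"
proof -
  have int: "integrable M (\<lambda>\<omega>. V i \<omega> * V j \<omega>)" if "i \<in> J" "j \<in> J" for i j
    using that V bound
    by (intro integrable_const_bound[where B = 1] AE_I2)
       (auto simp: abs_mult intro!: mult_le_one borel_measurable_times)
  have sq: "(\<lambda>\<omega>. (\<Sum>i\<in>J. V i \<omega>)\<^sup>2) = (\<lambda>\<omega>. \<Sum>i\<in>J. \<Sum>j\<in>J. V i \<omega> * V j \<omega>)"
    by (simp add: power2_eq_square sum_product)
  show "integrable M (\<lambda>\<omega>. (\<Sum>i\<in>J. V i \<omega>)\<^sup>2)"
    unfolding sq by (intro Bochner_Integration.integrable_sum int)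
  have "expectation (\<lambda>\<omega>. (\<Sum>i\<in>J. V i \<omega>)\<^sup>2) = (\<Sum>i\<in>J. \<Sum>j\<in>J. expectation (\<lambda>\<omega>. V i \<omega> * V j \<omega>))"
    unfolding sq by (simp add: int)
  also have "\<dots> \<le> (\<Sum>i\<in>J. \<Sum>j\<in>J. r i j)"
    by (intro sum_mono corr)
  finally show "expectation (\<lambda>\<omega>. (\<Sum>i\<in>J. V i \<omega>)\<^sup>2) \<le> (\<Sum>i\<in>J. \<Sum>j\<in>J. r i j)" .
qed

text \<open>Chebyshev's inequality in a form that serves both sums of the proof: \<open>r\<close> is
  the indicator of neighbouring ranks for the anomalies and a mixing coefficient for the
  inputs.\<close>

lemma (in prob_space) prob_sum_ge_le:
  fixes V :: "'i \<Rightarrow> 'a \<Rightarrow> real"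
  assumes J: "finite J" and V: "\<And>i. i \<in> J \<Longrightarrow> V i \<in> borel_measurable M"
    and bound: "\<And>i \<omega>. i \<in> J \<Longrightarrow> \<omega> \<in> space M \<Longrightarrow> \<bar>V i \<omega>\<bar> \<le> 1"
    and corr: "\<And>i j. i \<in> J \<Longrightarrow> j \<in> J \<Longrightarrow> expectation (\<lambda>\<omega>. V i \<omega> * V j \<omega>) \<le> r i j"
    and a: "0 < a"
  shows "prob {\<omega> \<in> space M. a \<le> \<bar>\<Sum>i\<in>J. V i \<omega>\<bar>} \<le> (\<Sum>i\<in>J. \<Sum>j\<in>J. r i j) / a\<^sup>2"
proof -
  note sq = expectation_sum_square_le[OF J V bound corr]
  have "prob {\<omega> \<in> space M. a \<le> \<bar>\<Sum>i\<in>J. V i \<omega>\<bar>} \<le> expectation (\<lambda>\<omega>. (\<Sum>i\<in>J. V i \<omega>)\<^sup>2) / a\<^sup>2"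
    using V a by (intro second_moment_method sq(1) borel_measurable_sum)
  also have "\<dots> \<le> (\<Sum>i\<in>J. \<Sum>j\<in>J. r i j) / a\<^sup>2"
    using a by (intro divide_right_mono sq(2)) auto
  finally show ?thesis .
qed

text \<open>Every index has at most three neighbours, itself included.\<close>

lemma sum_sum_neighbours_le:
  "(\<Sum>i\<in>{m..n::nat}. \<Sum>j\<in>{m..n}. of_bool (i \<le> j + 1 \<and> j \<le> i + 1)) \<le> 3 * real (card {m..n})"
proof -
  have "(\<Sum>j\<in>{m..n}. of_bool (i \<le> j + 1 \<and> j \<le> i + 1)) \<le> (3::real)" for i
  proof -
    have "(\<Sum>j\<in>{m..n}. of_bool (i \<le> j + 1 \<and> j \<le> i + 1)) = real (card ({m..n} \<inter> {j. i \<le> j + 1 \<and> j \<le> i + 1}))"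
      by (simp add: of_bool_def sum.If_cases)
    also have "\<dots> \<le> real (card {i - 1, i, i + 1})"
      by (intro of_nat_mono card_mono) auto
    also have "\<dots> \<le> 3" by (simp add: card_insert_if)
    finally show ?thesis .
  qed
  then have "(\<Sum>i\<in>{m..n::nat}. \<Sum>j\<in>{m..n}. of_bool (i \<le> j + 1 \<and> j \<le> i + 1)) \<le> (\<Sum>i\<in>{m..n}. 3::real)"
    by (intro sum_mono)
  then show ?thesis by simp
qed

text \<open>Both laws are the square of the common marginal law. Hence the anomalies at any two
  distinct times have the joint law of those at times 2 and 1, which occur in condition
  (ii).\<close>

lemma (in prob_space) distr_pair_iid:
  fixes W :: "int \<Rightarrow> 'a \<Rightarrow> 'b::second_countable_topology"
  assumes ind: "indep_vars (\<lambda>_. borel) W UNIV"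
    and id: "\<And>i j. distr M borel (W i) = distr M borel (W j)"
    and "i \<noteq> j" "k \<noteq> l"
  shows "distr M (borel \<Otimes>\<^sub>M borel) (\<lambda>\<omega>. (W i \<omega>, W j \<omega>)) = distr M (borel \<Otimes>\<^sub>M borel) (\<lambda>\<omega>. (W k \<omega>, W l \<omega>))"
proof -
  have *: "distr M (borel \<Otimes>\<^sub>M borel) (\<lambda>\<omega>. (W i \<omega>, W j \<omega>)) = distr M borel (W i) \<Otimes>\<^sub>M distr M borel (W j)"
    if "i \<noteq> j" for i j
  proof -
    have "indep_var borel ((\<lambda>f. f i) \<circ> (\<lambda>\<omega>. \<lambda>k\<in>{i}. W k \<omega>)) borel ((\<lambda>f. f j) \<circ> (\<lambda>\<omega>. \<lambda>k\<in>{j}. W k \<omega>))"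
      using that by (intro indep_var_compose[OF indep_var_restrict[OF ind]]) auto
    then have "indep_var borel (W i) borel (W j)" by (simp add: o_def)
    then show ?thesis unfolding indep_var_distribution_eq by simp
  qed
  show ?thesis unfolding *[OF \<open>i \<noteq> j\<close>] *[OF \<open>k \<noteq> l\<close>] id[of i k] id[of j l] ..
qed

lemma (in prob_space) indep_var_blocks:
  assumes ind: "indep_vars (\<lambda>_. N) W UNIV"
    and "{i, j} \<inter> {k, l} = {}"
    and F: "F \<in> measurable (N \<Otimes>\<^sub>M N) borel" and G: "G \<in> measurable (N \<Otimes>\<^sub>M N) borel"
  shows "indep_var borel (\<lambda>\<omega>. F (W i \<omega>, W j \<omega>)) borel (\<lambda>\<omega>. G (W k \<omega>, W l \<omega>))"
proof -
  have [measurable]: "(\<lambda>f. F (f i, f j)) \<in> measurable (PiM {i, j} (\<lambda>_. N)) borel"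
    "(\<lambda>f. G (f k, f l)) \<in> measurable (PiM {k, l} (\<lambda>_. N)) borel"
    by (rule measurable_compose[OF _ F], simp) (rule measurable_compose[OF _ G], simp)
  have "indep_var borel ((\<lambda>f. F (f i, f j)) \<circ> (\<lambda>\<omega>. \<lambda>m\<in>{i, j}. W m \<omega>))
      borel ((\<lambda>f. G (f k, f l)) \<circ> (\<lambda>\<omega>. \<lambda>m\<in>{k, l}. W m \<omega>))"
    using assms(2) by (intro indep_var_compose[OF indep_var_restrict[OF ind]]) auto
  then show ?thesis by (simp add: o_def)
qed

text \<open>Neighbouring terms share one variable, so the summands are 1-dependent.\<close>

lemma (in prob_space) prob_neighbour_sum_deviation_le:
  fixes W :: "int \<Rightarrow> 'a \<Rightarrow> 'b::second_countable_topology"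
    and f :: "nat \<Rightarrow> 'b \<times> 'b \<Rightarrow> real"
  assumes ind: "indep_vars (\<lambda>_. borel) W UNIV"
    and id: "\<And>i j. distr M borel (W i) = distr M borel (W j)"
    and inj: "inj_on \<sigma> {1..n}"
    and f[measurable]: "\<And>t. f t \<in> borel_measurable (borel \<Otimes>\<^sub>M borel)"
    and f01: "\<And>t z. 0 \<le> f t z" "\<And>t z. f t z \<le> 1"
    and a: "0 < a"
  shows "prob {\<omega> \<in> space M. a \<le> \<bar>\<Sum>t = 2..n. f t (W (\<sigma> t) \<omega>, W (\<sigma> (t - 1)) \<omega>)
    - expectation (\<lambda>\<omega>. f t (W 2 \<omega>, W 1 \<omega>))\<bar>} \<le> 3 * real n / a\<^sup>2"
proof -
  have W[measurable]: "W i \<in> measurable M borel" for i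
    using ind by (simp add: indep_vars_def2)
  define m where "m t = expectation (\<lambda>\<omega>. f t (W 2 \<omega>, W 1 \<omega>))" for t
  define V where "V t \<omega> = f t (W (\<sigma> t) \<omega>, W (\<sigma> (t - 1)) \<omega>) - m t" for t \<omega>
  have V_meas[measurable]: "V t \<in> borel_measurable M" for t
    unfolding V_def by measurable
  have int_f: "integrable M (\<lambda>\<omega>. f t (W i \<omega>, W j \<omega>))" for t i j
    using f01 by (intro integrable_const_bound[where B = 1]) auto
  have "0 \<le> m t" "m t \<le> 1" for t
    unfolding m_def using f01 int_f[of t 2 1] by (auto intro!: integral_nonneg_AE integral_le_const)
  then have V_le: "\<bar>V t \<omega>\<bar> \<le> 1" for t \<omega>
    using f01(1)[of t "(W (\<sigma> t) \<omega>, W (\<sigma> (t - 1)) \<omega>)"] f01(2)[of t "(W (\<sigma> t) \<omega>, W (\<sigma> (t - 1)) \<omega>)"]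
    unfolding V_def by (smt (verit))
  have int_V: "integrable M (V t)" for t
    using V_le by (intro integrable_const_bound[where B = 1]) auto
  have EV: "expectation (V t) = 0" if "t \<in> {2..n}" for t
  proof -
    have "t \<in> {1..n}" "t - 1 \<in> {1..n}" "t \<noteq> t - 1" using that by auto
    then have "\<sigma> t \<noteq> \<sigma> (t - 1)" using inj_onD[OF inj] by blast
    note law = distr_pair_iid[OF ind id this, of 2 1]
    have "expectation (\<lambda>\<omega>. f t (W (\<sigma> t) \<omega>, W (\<sigma> (t - 1)) \<omega>)) = m t"
      using integral_distr[of "\<lambda>\<omega>. (W (\<sigma> t) \<omega>, W (\<sigma> (t - 1)) \<omega>)" M "borel \<Otimes>\<^sub>M borel" "f t"]
        integral_distr[of "\<lambda>\<omega>. (W 2 \<omega>, W 1 \<omega>)" M "borel \<Otimes>\<^sub>M borel" "f t"]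
      by (simp add: law m_def del: One_nat_def)
    then show ?thesis unfolding V_def using int_f by (simp add: prob_space)
  qed
  have corr: "expectation (\<lambda>\<omega>. V s \<omega> * V t \<omega>) \<le> of_bool (s \<le> t + 1 \<and> t \<le> s + 1)"
    if "s \<in> {2..n}" "t \<in> {2..n}" for s t
  proof (cases "s \<le> t + 1 \<and> t \<le> s + 1")
    \<comment> \<open>Neighbouring terms, the diagonal included, only get the trivial bound.\<close>
    case True
    have "expectation (\<lambda>\<omega>. V s \<omega> * V t \<omega>) \<le> 1"
    proof (rule integral_le_const)
      show "integrable M (\<lambda>\<omega>. V s \<omega> * V t \<omega>)"
        using V_le by (intro integrable_const_bound[where B = 1]) (auto simp: abs_mult intro!: mult_le_one)
      show "AE \<omega> in M. V s \<omega> * V t \<omega> \<le> 1"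
      proof (rule AE_I2)
        fix \<omega>
        have "\<bar>V s \<omega> * V t \<omega>\<bar> \<le> 1"
          unfolding abs_mult using V_le by (intro mult_le_one) auto
        then show "V s \<omega> * V t \<omega> \<le> 1" by linarith
      qed
    qed
    then show ?thesis using True by simp
  next
    case False
    \<comment> \<open>Ranks at distance at least 2 use disjoint pairs of ranks, and injectivity of
      \<open>\<sigma>\<close> keeps the pairs of times disjoint. The expectation then factors into
      two vanishing means.\<close>
    have "{s, s - 1} \<subseteq> {1..n}" "{t, t - 1} \<subseteq> {1..n}" "{s, s - 1} \<inter> {t, t - 1} = {}"
      using False that by auto
    from inj_on_image_Int[OF inj this(1,2)] this(3)
    have "{\<sigma> s, \<sigma> (s - 1)} \<inter> {\<sigma> t, \<sigma> (t - 1)} = {}"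
      by (simp del: One_nat_def)
    from indep_var_blocks[OF ind this, of "\<lambda>z. f s z - m s" "\<lambda>z. f t z - m t"]
    have "indep_var borel (V s) borel (V t)" unfolding V_def by simp
    from indep_var_lebesgue_integral[OF this int_V int_V]
    show ?thesis using False that by (simp add: EV)
  qed
  have "prob {\<omega> \<in> space M. a \<le> \<bar>\<Sum>t = 2..n. V t \<omega>\<bar>}
      \<le> (\<Sum>s = 2..n. \<Sum>t = 2..n. of_bool (s \<le> t + 1 \<and> t \<le> s + 1)) / a\<^sup>2"
    using V_le a by (intro prob_sum_ge_le corr) auto
  also have "\<dots> \<le> (3 * real n) / a\<^sup>2"
    by (intro divide_right_mono order_trans[OF sum_sum_neighbours_le]) auto
  finally show ?thesis unfolding V_def m_def .
qed

section \<open>Anomalies\<close>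

text \<open>Rectangles are an intersection-stable generator of the product sigma-algebra. On
  rectangles the probability factors first between the two sequences and then, within each, over the
  times. Finite sets of times suffice for independence.\<close>

lemma indep_vars_anomaly_pairs:
  assumes "prob_space M" and "iid M \<delta>" "iid M \<epsilon>" and ind: "indep_sequences M X \<delta> \<epsilon>"
  shows "prob_space.indep_vars M (\<lambda>_. borel) (\<lambda>i \<omega>. (\<delta> i \<omega>, \<epsilon> i \<omega>)) UNIV"
proof -
  interpret prob_space M by fact
  have \<delta>: "indep_vars (\<lambda>_. borel) \<delta> UNIV" and \<epsilon>: "indep_vars (\<lambda>_. borel) \<epsilon> UNIV"
    using assms by (auto simp: iid_def)
  have [measurable]: "\<delta> i \<in> borel_measurable M" "\<epsilon> i \<in> borel_measurable M" for i
    using \<delta> \<epsilon> by (auto simp: indep_vars_def2)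
  let ?W = "\<lambda>i \<omega>. (\<delta> i \<omega>, \<epsilon> i \<omega>)"
  let ?E = "{a \<times> b | (a :: real set) (b :: real set). a \<in> sets borel \<and> b \<in> sets borel}"
  have split: "prob (\<Inter>j\<in>J. ?W j -` (a j \<times> b j) \<inter> space M)
      = prob (\<Inter>j\<in>J. \<delta> j -` a j \<inter> space M) * prob (\<Inter>j\<in>J. \<epsilon> j -` b j \<inter> space M)"
    if J: "J \<noteq> {}" "finite J" and ab: "\<And>j. j \<in> J \<Longrightarrow> a j \<in> sets borel" "\<And>j. j \<in> J \<Longrightarrow> b j \<in> sets borel"
    for J and a b :: "int \<Rightarrow> real set"
  proof -
    let ?Z = "\<lambda>(i::nat) \<omega> t. ([X, \<delta>, \<epsilon>] ! i) t \<omega>"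
    have cyl: "{z. \<forall>j\<in>J. z j \<in> c j} \<in> sets (PiM UNIV (\<lambda>_. borel))"
      if c: "\<And>j. j \<in> J \<Longrightarrow> c j \<in> sets borel" for c :: "int \<Rightarrow> real set"
    proof -
      have "{z \<in> space (PiM UNIV (\<lambda>_. borel)). \<forall>j\<in>J. z j \<in> c j} \<in> sets (PiM UNIV (\<lambda>_. borel))"
        using c \<open>finite J\<close> by measurable
      then show ?thesis by (simp add: space_PiM)
    qed
    \<comment> \<open>Positions 1 and 2 of the list \<open>[X, \<delta>, \<epsilon>]\<close> hold
      the anomalies; each receives a cylinder over \<open>J\<close>.\<close>
    define D where "D = (\<lambda>i::nat. if i = 1 then {z. \<forall>j\<in>J. z j \<in> a j} else {z. \<forall>j\<in>J. z j \<in> b j})"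
    have "prob (\<Inter>i\<in>{1, 2}. ?Z i -` D i \<inter> space M) = (\<Prod>i\<in>{1, 2}. prob (?Z i -` D i \<inter> space M))"
      using ind unfolding indep_sequences_def
      by (rule indep_varsD) (auto simp: D_def intro!: cyl ab)
    moreover have "(\<Inter>i\<in>{1, 2}. ?Z i -` D i \<inter> space M) = (\<Inter>j\<in>J. ?W j -` (a j \<times> b j) \<inter> space M)"
      "?Z 1 -` D 1 \<inter> space M = (\<Inter>j\<in>J. \<delta> j -` a j \<inter> space M)"
      "?Z 2 -` D 2 \<inter> space M = (\<Inter>j\<in>J. \<epsilon> j -` b j \<inter> space M)"
      using J by (auto simp: D_def)
    ultimately show ?thesis by simp
  qed
  have fin: "indep_vars (\<lambda>_. borel \<Otimes>\<^sub>M borel) ?W J" if J: "J \<noteq> {}" "finite J" for J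
  proof (subst indep_vars_finite[where E = "\<lambda>_. ?E"])
    show "Int_stable ?E"
      unfolding Int_stable_def by (auto simp: Times_Int_Times) (metis sets.Int)
    show "\<forall>A\<in>J \<rightarrow> ?E. prob (\<Inter>j\<in>J. ?W j -` A j \<inter> space M) = (\<Prod>j\<in>J. prob (?W j -` A j \<inter> space M))"
    proof
      fix A assume "A \<in> J \<rightarrow> ?E"
      then have "\<forall>j\<in>J. \<exists>(a :: real set) (b :: real set). A j = a \<times> b \<and> a \<in> sets borel \<and> b \<in> sets borel" by (auto simp: Pi_iff)
      then obtain a b :: "int \<Rightarrow> real set" where A: "\<And>j. j \<in> J \<Longrightarrow> A j = a j \<times> b j"
        and ab: "\<And>j. j \<in> J \<Longrightarrow> a j \<in> sets borel" "\<And>j. j \<in> J \<Longrightarrow> b j \<in> sets borel"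
        by metis
      have "prob (\<Inter>j\<in>J. ?W j -` A j \<inter> space M)
          = prob (\<Inter>j\<in>J. \<delta> j -` a j \<inter> space M) * prob (\<Inter>j\<in>J. \<epsilon> j -` b j \<inter> space M)"
        using A split[OF J ab] by simp
      also have "prob (\<Inter>j\<in>J. \<delta> j -` a j \<inter> space M) = (\<Prod>j\<in>J. prob (\<delta> j -` a j \<inter> space M))"
        using J ab by (intro indep_varsD[OF \<delta>]) auto
      also have "prob (\<Inter>j\<in>J. \<epsilon> j -` b j \<inter> space M) = (\<Prod>j\<in>J. prob (\<epsilon> j -` b j \<inter> space M))"
        using J ab by (intro indep_varsD[OF \<epsilon>]) auto
      \<comment> \<open>Used at a single time, \<open>split\<close> merges the two marginals back
        into the probability of a rectangle.\<close>
      also have "(\<Prod>j\<in>J. prob (\<delta> j -` a j \<inter> space M)) * (\<Prod>j\<in>J. prob (\<epsilon> j -` b j \<inter> space M))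
          = (\<Prod>j\<in>J. prob (?W j -` A j \<inter> space M))"
        unfolding prod.distrib[symmetric]
        using A split[of "{j}" a b for j] ab by (intro prod.cong) auto
      finally show "prob (\<Inter>j\<in>J. ?W j -` A j \<inter> space M) = (\<Prod>j\<in>J. prob (?W j -` A j \<inter> space M))" .
    qed
  next
    fix j :: int
    show "sets (borel \<Otimes>\<^sub>M borel) = sigma_sets (space (borel \<Otimes>\<^sub>M borel)) ?E"
      by (simp add: sets_pair_measure space_pair_measure)
    show "space (borel \<Otimes>\<^sub>M borel) \<in> ?E"
      by (intro CollectI exI[of _ UNIV]) (simp add: space_pair_measure)
    show "?E \<subseteq> Pow (space (borel \<Otimes>\<^sub>M borel))"
      by (simp add: space_pair_measure)
  qed (use J in simp_all)
  have "indep_vars (\<lambda>_. borel \<Otimes>\<^sub>M borel) ?W UNIV"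
    unfolding indep_vars_def2
  proof (intro conjI ballI)
    show "indep_sets (\<lambda>i. {?W i -` A \<inter> space M |A. A \<in> sets (borel \<Otimes>\<^sub>M borel)}) UNIV"
      using fin by (subst indep_sets_finite_index_sets) (auto simp: indep_vars_def2)
  qed simp
  then show ?thesis by (simp add: borel_prod)
qed

text \<open>The three sequences are grouped into two blocks, the second of which is read as one
  sequence of pairs. This product law is what permits freezing all inputs at once.\<close>

lemma distr_inputs_anomaly_pairs:
  assumes "prob_space M" and ind: "indep_sequences M X \<delta> \<epsilon>"
  shows "distr M (PiM UNIV (\<lambda>_. borel) \<Otimes>\<^sub>M PiM UNIV (\<lambda>_. borel)) (\<lambda>\<omega>. (\<lambda>t. X t \<omega>, \<lambda>t. (\<delta> t \<omega>, \<epsilon> t \<omega>)))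
    = distr M (PiM UNIV (\<lambda>_. borel)) (\<lambda>\<omega> t. X t \<omega>) \<Otimes>\<^sub>M distr M (PiM UNIV (\<lambda>_. borel)) (\<lambda>\<omega> t. (\<delta> t \<omega>, \<epsilon> t \<omega>))"
proof -
  interpret prob_space M by fact
  let ?Z = "\<lambda>(i::nat) \<omega> t. ([X, \<delta>, \<epsilon>] ! i) t \<omega>"
  let ?P = "PiM UNIV (\<lambda>_::int. borel :: real measure)"
  have m1: "(\<lambda>f. f 0) \<in> measurable (PiM {0::nat} (\<lambda>_. ?P)) ?P"
    by measurable
  have m2: "(\<lambda>f t. (f 1 t, f 2 t)) \<in> measurable (PiM {1::nat, 2} (\<lambda>_. ?P)) (PiM UNIV (\<lambda>_. borel :: (real \<times> real) measure))"
  proof (rule measurable_PiM_single')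
    fix t :: int
    have c: "(\<lambda>f. f i t) \<in> borel_measurable (PiM {1::nat, 2} (\<lambda>_. ?P))" if "i \<in> {1, 2}" for i
      by (rule measurable_compose[where N = ?P]; rule measurable_component_singleton) (use that in auto)
    show "(\<lambda>f. (f 1 t, f 2 t)) \<in> borel_measurable (PiM {1::nat, 2} (\<lambda>_. ?P))"
      unfolding borel_prod[symmetric] by (intro measurable_Pair c) auto
  qed auto
  have "indep_var (PiM {0} (\<lambda>_. ?P)) (\<lambda>\<omega>. \<lambda>i\<in>{0}. ?Z i \<omega>) (PiM {1, 2} (\<lambda>_. ?P)) (\<lambda>\<omega>. \<lambda>i\<in>{1, 2}. ?Z i \<omega>)"
    using ind unfolding indep_sequences_def by (rule indep_var_restrict) auto
  from distr_Pair_compose[OF this m1 m2] show ?thesis by simp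
qed

text \<open>Since each factor is the same at all times for iid anomalies, this product form shows
  that the pairs are identically distributed.\<close>

lemma distr_anomaly_pair:
  assumes "prob_space M" and ind: "indep_sequences M X \<delta> \<epsilon>"
  shows "distr M (borel \<Otimes>\<^sub>M borel) (\<lambda>\<omega>. (\<delta> i \<omega>, \<epsilon> i \<omega>)) = distr M borel (\<delta> i) \<Otimes>\<^sub>M distr M borel (\<epsilon> i)"
proof -
  interpret prob_space M by fact
  let ?Z = "\<lambda>(i::nat) \<omega> t. ([X, \<delta>, \<epsilon>] ! i) t \<omega>"
  let ?P = "PiM UNIV (\<lambda>_::int. borel :: real measure)"
  have m: "(\<lambda>f. f k i) \<in> borel_measurable (PiM {k} (\<lambda>_. ?P))" for k :: nat
    by (rule measurable_compose[where N = ?P]; rule measurable_component_singleton) auto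
  have "indep_var (PiM {1} (\<lambda>_. ?P)) (\<lambda>\<omega>. \<lambda>i\<in>{1}. ?Z i \<omega>) (PiM {2} (\<lambda>_. ?P)) (\<lambda>\<omega>. \<lambda>i\<in>{2}. ?Z i \<omega>)"
    using ind unfolding indep_sequences_def by (rule indep_var_restrict) auto
  from distr_Pair_compose[OF this m m] show ?thesis by simp
qed

section \<open>Stationary mixing inputs\<close>

text \<open>A real supremum dominates its family only if the family is bounded; here 1 is a
  bound.\<close>

lemma abs_cov_le_alpha_coeff:
  assumes "prob_space M"
    and X: "\<And>t. X t \<in> borel_measurable M"
    and A: "A \<in> generated_events M X {..0}" and B: "B \<in> generated_events M X {int k..}"
  shows "\<bar>measure M (A \<inter> B) - measure M A * measure M B\<bar> \<le> alpha_coeff M X k"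
proof -
  interpret prob_space M by fact
  have "\<bar>prob (A \<inter> B) - prob A * prob B\<bar> \<le> 1" for A B
  proof -
    have "prob A * prob B \<le> 1" "0 \<le> prob A * prob B" by (auto intro: mult_le_one)
    then show ?thesis using prob_le_1[of "A \<inter> B"] measure_nonneg[of M "A \<inter> B"] by linarith
  qed
  then have "bdd_above ((\<lambda>(A, B). \<bar>prob (A \<inter> B) - prob A * prob B\<bar>)
      ` (generated_events M X {..0} \<times> generated_events M X {int k..}))"
    by (intro bdd_aboveI2[where M = 1]) auto
  from cSUP_upper[OF _ this, of "(A, B)"] show ?thesis
    using A B by (simp add: alpha_coeff_def)
qed

text \<open>Moves the earlier time to 0, where the mixing coefficient places the past. The case
  \<open>k = 0\<close> yields the equality of the marginals.\<close>

lemma strictly_stationary_joint: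
  assumes stat: "strictly_stationary M X" and X[measurable]: "\<And>t. X t \<in> borel_measurable M"
    and S: "S \<in> sets borel"
  shows "measure M {\<omega> \<in> space M. X s \<omega> \<in> S \<and> X (s + k) \<omega> \<in> S} = measure M {\<omega> \<in> space M. X 0 \<omega> \<in> S \<and> X k \<omega> \<in> S}"
proof -
  let ?J = "{0, k}" and ?P = "PiM {0, k} (\<lambda>_. borel :: real measure)"
  define C where "C = {f \<in> space ?P. f 0 \<in> S \<and> f k \<in> S}"
  have C: "C \<in> sets ?P" unfolding C_def using S by measurable
  have pre: "measure (finite_dim_law M Z ?J) C = measure M {\<omega> \<in> space M. Z 0 \<omega> \<in> S \<and> Z k \<omega> \<in> S}"
    if [measurable]: "\<And>t. Z t \<in> borel_measurable M" for Z
    unfolding finite_dim_law_def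
    by (subst measure_distr) (auto simp: C intro!: arg_cong[where f = "measure M"], auto simp: C_def space_PiM)
  have "finite_dim_law M (\<lambda>t. X (t + s)) ?J = finite_dim_law M X ?J"
    using stat by (simp add: strictly_stationary_def)
  then show ?thesis
    using pre[of X] pre[of "\<lambda>t. X (t + s)"] by (simp add: add.commute)
qed

lemma strictly_stationary_measure_eq:
  assumes "strictly_stationary M X" "\<And>t. X t \<in> borel_measurable M" "S \<in> sets borel"
  shows "measure M {\<omega> \<in> space M. X s \<omega> \<in> S} = measure M {\<omega> \<in> space M. X t \<omega> \<in> S}"
  using strictly_stationary_joint[OF assms, of s 0] strictly_stationary_joint[OF assms, of t 0] by simp

section \<open>Frequencies and extremes of stationary inputs\<close>

lemma Cesaro_mean_tendsto_0:
  fixes a :: "nat \<Rightarrow> real"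
  assumes "a \<longlonglongrightarrow> 0"
  shows "(\<lambda>n. (\<Sum>k<n. a k) / real n) \<longlonglongrightarrow> 0"
proof (rule LIMSEQ_I)
  fix r :: real assume r: "0 < r"
  from LIMSEQ_D[OF assms, of "r / 2"] obtain m where m: "\<And>k. m \<le> k \<Longrightarrow> \<bar>a k\<bar> < r / 2"
    using r by auto
  \<comment> \<open>The head is a constant, eventually below half of \<open>n * r\<close>; each term
    of the tail is below \<open>r / 2\<close>.\<close>
  define C where "C = (\<Sum>k<m. \<bar>a k\<bar>)"
  obtain n0 where n0: "2 * C / r < real n0" using reals_Archimedean2 by blast
  show "\<exists>no. \<forall>n\<ge>no. norm ((\<Sum>k<n. a k) / real n - 0) < r"
  proof (intro exI allI impI)
    fix n assume n: "max (Suc n0) m \<le> n"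
    have "\<bar>\<Sum>k<n. a k\<bar> \<le> (\<Sum>k<n. \<bar>a k\<bar>)" by (rule sum_abs)
    also have "\<dots> = C + (\<Sum>k\<in>{m..<n}. \<bar>a k\<bar>)"
      using n unfolding C_def lessThan_atLeast0 by (intro sum.atLeastLessThan_concat[symmetric]) auto
    also have "(\<Sum>k\<in>{m..<n}. \<bar>a k\<bar>) \<le> (\<Sum>k\<in>{m..<n}. r / 2)"
      using m by (intro sum_mono less_imp_le) auto
    also have "\<dots> \<le> real n * (r / 2)" using r by simp
    also have "C < real n * (r / 2)"
    proof -
      have "2 * C / r < real n" using n0 n by simp
      then show ?thesis using r by (simp add: field_simps)
    qed
    finally have "\<bar>\<Sum>k<n. a k\<bar> < real n * r" by (simp add: mult.commute)
    then show "norm ((\<Sum>k<n. a k) / real n - 0) < r"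
      using n by (simp add: divide_less_eq mult.commute)
  qed
qed

text \<open>For fixed \<open>s\<close>, a distance \<open>k\<close> is attained by at most two
  times, \<open>s + k\<close> and \<open>s - k\<close>. The Boolean selects the sign; counting
  \<open>k = 0\<close> twice is harmless as \<open>a\<close> is nonnegative.\<close>

lemma sum_sum_distance_le:
  fixes a :: "nat \<Rightarrow> real"
  assumes "\<And>k. 0 \<le> a k"
  shows "(\<Sum>s = 1..int n. \<Sum>t = 1..int n. a (nat \<bar>s - t\<bar>)) \<le> 2 * real n * (\<Sum>k<n. a k)"
proof -
  have "(\<Sum>t = 1..int n. a (nat \<bar>s - t\<bar>)) \<le> 2 * (\<Sum>k<n. a k)" if s: "s \<in> {1..int n}" for s
  proof -
    have "(\<Sum>t = 1..int n. a (nat \<bar>s - t\<bar>)) \<le> (\<Sum>(k, b)\<in>{..<n} \<times> (UNIV :: bool set). a k)"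
    proof (rule sum_le_included[where i = "\<lambda>(k, b). if b then s + int k else s - int k"])
      show "\<forall>t\<in>{1..int n}. \<exists>z\<in>{..<n} \<times> UNIV. (case z of (k, b) \<Rightarrow> if b then s + int k else s - int k) = t
          \<and> a (nat \<bar>s - t\<bar>) \<le> (case z of (k, b) \<Rightarrow> a k)"
      proof
        fix t assume "t \<in> {1..int n}"
        with s show "\<exists>z\<in>{..<n} \<times> UNIV. (case z of (k, b) \<Rightarrow> if b then s + int k else s - int k) = t
            \<and> a (nat \<bar>s - t\<bar>) \<le> (case z of (k, b) \<Rightarrow> a k)"
          by (intro bexI[of _ "(nat \<bar>s - t\<bar>, s \<le> t)"]) auto
      qed
    qed (use assms in auto)
    also have "\<dots> = 2 * (\<Sum>k<n. a k)"
      by (simp add: sum.cartesian_product[symmetric] UNIV_bool sum_distrib_left)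
    finally show ?thesis .
  qed
  then have "(\<Sum>s = 1..int n. \<Sum>t = 1..int n. a (nat \<bar>s - t\<bar>)) \<le> (\<Sum>s = 1..int n. 2 * (\<Sum>k<n. a k))"
    by (rule sum_mono)
  then show ?thesis by simp
qed

text \<open>A weak law of large numbers: the second moment of the centred count is at most
  \<open>2 * n\<close> times the sum of the first \<open>n\<close> mixing coefficients. Their
  averages vanish, so this is of smaller order than the square of \<open>n\<close>.\<close>

lemma alpha_mixing_frequency_tendsto:
  assumes "prob_space M" and X[measurable]: "\<And>t. X t \<in> borel_measurable M"
    and stat: "strictly_stationary M X" and mix: "alpha_mixing M X"
    and S[measurable]: "S \<in> sets borel" and a: "0 < a"
  shows "(\<lambda>n. measure M {\<omega> \<in> space M. a * real n \<le> \<bar>\<Sum>s = 1..int n. indicator S (X s \<omega>)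
    - measure M {\<omega> \<in> space M. X 1 \<omega> \<in> S}\<bar>}) \<longlonglongrightarrow> 0"
proof -
  interpret prob_space M by fact
  define q where "q = prob {\<omega> \<in> space M. X 1 \<omega> \<in> S}"
  define V where "V s \<omega> = indicator S (X s \<omega>) - q" for s \<omega>
  have q: "0 \<le> q" "q \<le> 1" by (simp_all add: q_def)
  have prob_S: "prob {\<omega> \<in> space M. X s \<omega> \<in> S} = q" for s
    unfolding q_def by (rule strictly_stationary_measure_eq[OF stat X S])
  have cov: "\<bar>prob {\<omega> \<in> space M. X s \<omega> \<in> S \<and> X t \<omega> \<in> S} - q * q\<bar> \<le> alpha_coeff M X (nat \<bar>s - t\<bar>)"
    if "s \<le> t" for s t
  proof -
    define k where "k = nat (t - s)"
    have t: "t = s + int k" using that by (simp add: k_def)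
    have gen: "{\<omega> \<in> space M. X u \<omega> \<in> S} \<in> generated_events M X I" if "u \<in> I" for u I
    proof -
      have "{\<omega> \<in> space M. X u \<omega> \<in> S} = X u -` S \<inter> space M" by auto
      then show ?thesis
        unfolding generated_events_def using that S by (intro sigma_sets.Basic) blast
    qed
    have "{\<omega> \<in> space M. X 0 \<omega> \<in> S} \<inter> {\<omega> \<in> space M. X (int k) \<omega> \<in> S}
        = {\<omega> \<in> space M. X 0 \<omega> \<in> S \<and> X (int k) \<omega> \<in> S}" by auto
    with abs_cov_le_alpha_coeff[OF \<open>prob_space M\<close> X, 
      where A = "{\<omega> \<in> space M. X 0 \<omega> \<in> S}" and B = "{\<omega> \<in> space M. X (int k) \<omega> \<in> S}" and k = k]
    show ?thesis
      unfolding t by (simp add: gen prob_S strictly_stationary_joint[OF stat X S])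
  qed
  have \<alpha>: "0 \<le> alpha_coeff M X k" for k
    using cov[of 0 "int k"] by (simp add: order_trans[OF abs_ge_zero])
  have corr: "expectation (\<lambda>\<omega>. V s \<omega> * V t \<omega>) \<le> alpha_coeff M X (nat \<bar>s - t\<bar>)" for s t
  proof -
    have ind: "integrable M (\<lambda>\<omega>. indicator S (X s \<omega>) :: real)"
      and E: "expectation (\<lambda>\<omega>. indicator S (X s \<omega>)) = q" for s
    proof -
      have *: "(\<integral>\<omega>. indicator S (X s \<omega>) \<partial>M) = (\<integral>\<omega>. indicator {\<omega> \<in> space M. X s \<omega> \<in> S} \<omega> \<partial>M)"
        by (intro Bochner_Integration.integral_cong) (auto split: split_indicator)
      show "integrable M (\<lambda>\<omega>. indicator S (X s \<omega>) :: real)"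
        by (intro integrable_const_bound[where B = 1]) auto
      show "expectation (\<lambda>\<omega>. indicator S (X s \<omega>)) = q"
        unfolding * using prob_S by simp
    qed
    have E2: "expectation (\<lambda>\<omega>. indicator S (X s \<omega>) * indicator S (X t \<omega>)) = prob {\<omega> \<in> space M. X s \<omega> \<in> S \<and> X t \<omega> \<in> S}"
    proof -
      have "(\<integral>\<omega>. indicator S (X s \<omega>) * indicator S (X t \<omega>) \<partial>M :: real)
          = (\<integral>\<omega>. indicator {\<omega> \<in> space M. X s \<omega> \<in> S \<and> X t \<omega> \<in> S} \<omega> \<partial>M)"
        by (intro Bochner_Integration.integral_cong) (auto split: split_indicator)
      then show ?thesis by simp
    qed
    have ind2: "integrable M (\<lambda>\<omega>. indicator S (X s \<omega>) * indicator S (X t \<omega>) :: real)"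
      by (intro integrable_const_bound[where B = 1]) (auto split: split_indicator)
    have "expectation (\<lambda>\<omega>. V s \<omega> * V t \<omega>) = expectation (\<lambda>\<omega>. indicator S (X s \<omega>) * indicator S (X t \<omega>)
        - q * indicator S (X s \<omega>) - q * indicator S (X t \<omega>) + q * q)"
      by (simp add: V_def algebra_simps)
    also have "\<dots> = prob {\<omega> \<in> space M. X s \<omega> \<in> S \<and> X t \<omega> \<in> S} - q * q"
      using ind ind2 by (simp add: E E2 prob_space)
    also have "\<dots> \<le> alpha_coeff M X (nat \<bar>s - t\<bar>)"
      using cov[of s t] cov[of t s] by (cases "s \<le> t") (auto simp: conj_commute abs_minus_commute)
    finally show ?thesis .
  qed
  have V_le: "\<bar>V s \<omega>\<bar> \<le> 1" for s \<omega>
    using q by (auto simp: V_def split: split_indicator)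
  have le: "prob {\<omega> \<in> space M. a * real n \<le> \<bar>\<Sum>s = 1..int n. V s \<omega>\<bar>}
      \<le> 2 / a\<^sup>2 * ((\<Sum>k<n. alpha_coeff M X k) / real n)" if "0 < n" for n
  proof -
    have V_meas: "V s \<in> borel_measurable M" for s unfolding V_def by measurable
    have "prob {\<omega> \<in> space M. a * real n \<le> \<bar>\<Sum>s = 1..int n. V s \<omega>\<bar>}
        \<le> (\<Sum>s = 1..int n. \<Sum>t = 1..int n. alpha_coeff M X (nat \<bar>s - t\<bar>)) / (a * real n)\<^sup>2"
      using a that V_le V_meas by (intro prob_sum_ge_le corr) auto
    also have "\<dots> \<le> (2 * real n * (\<Sum>k<n. alpha_coeff M X k)) / (a * real n)\<^sup>2"
      by (intro divide_right_mono sum_sum_distance_le \<alpha>) auto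
    also have "\<dots> = 2 / a\<^sup>2 * ((\<Sum>k<n. alpha_coeff M X k) / real n)"
      using a that by (simp add: power2_eq_square field_simps)
    finally show ?thesis .
  qed
  have "(\<lambda>n. 2 / a\<^sup>2 * ((\<Sum>k<n. alpha_coeff M X k) / real n)) \<longlonglongrightarrow> 0"
    using mix unfolding alpha_mixing_def by (intro tendsto_mult_right_zero Cesaro_mean_tendsto_0)
  then have "(\<lambda>n. prob {\<omega> \<in> space M. a * real n \<le> \<bar>\<Sum>s = 1..int n. V s \<omega>\<bar>}) \<longlonglongrightarrow> 0"
    by (rule tendsto_sandwich[rotated 2, OF tendsto_const])
       (simp, rule eventually_mono[OF eventually_gt_at_top[of 0]], rule le)
  then show ?thesis unfolding V_def q_def .
qed

text \<open>A union bound over \<open>n\<close> inputs costs a factor \<open>n\<close>, while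
  Markov's inequality for the \<open>p\<close>-th moment gains \<open>n powr (- p)\<close>; the
  product vanishes because \<open>p\<close> exceeds 1.\<close>

lemma stationary_max_tendsto:
  assumes "prob_space M" and X[measurable]: "\<And>t. X t \<in> borel_measurable M"
    and stat: "strictly_stationary M X"
    and p: "1 < p" and int: "integrable M (\<lambda>\<omega>. \<bar>X 1 \<omega>\<bar> powr p)" and a: "0 < a"
  shows "(\<lambda>n. measure M {\<omega> \<in> space M. \<exists>s\<in>{1..int n}. a * real n < \<bar>X s \<omega>\<bar>}) \<longlonglongrightarrow> 0"
proof -
  interpret prob_space M by fact
  define C where "C = expectation (\<lambda>\<omega>. \<bar>X 1 \<omega>\<bar> powr p)"
  have le: "prob {\<omega> \<in> space M. \<exists>s\<in>{1..int n}. a * real n < \<bar>X s \<omega>\<bar>} \<le> C / a powr p * real n powr (1 - p)"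
    if n: "0 < n" for n
  proof -
    have single: "prob {\<omega> \<in> space M. a * real n < \<bar>X s \<omega>\<bar>} \<le> C / (a * real n) powr p" for s
    proof -
      have "prob {\<omega> \<in> space M. a * real n < \<bar>X s \<omega>\<bar>} = prob {\<omega> \<in> space M. a * real n < \<bar>X 1 \<omega>\<bar>}"
        using strictly_stationary_measure_eq[OF stat X, of "{x. a * real n < \<bar>x\<bar>}" s 1] by simp
      also have "\<dots> \<le> prob {\<omega> \<in> space M. (a * real n) powr p \<le> \<bar>X 1 \<omega>\<bar> powr p}"
        using a p by (intro finite_measure_mono) (auto intro!: powr_mono2)
      also have "\<dots> \<le> C / (a * real n) powr p"
        unfolding C_def using a n by (intro integral_Markov_inequality_measure[OF int, where A = "{}"]) auto
      finally show ?thesis .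
    qed
    have "{\<omega> \<in> space M. \<exists>s\<in>{1..int n}. a * real n < \<bar>X s \<omega>\<bar>} = (\<Union>s\<in>{1..int n}. {\<omega> \<in> space M. a * real n < \<bar>X s \<omega>\<bar>})"
      by auto
    then have "prob {\<omega> \<in> space M. \<exists>s\<in>{1..int n}. a * real n < \<bar>X s \<omega>\<bar>}
        \<le> (\<Sum>s\<in>{1..int n}. prob {\<omega> \<in> space M. a * real n < \<bar>X s \<omega>\<bar>})"
      by (simp, intro finite_measure_subadditive_finite) auto
    also have "\<dots> \<le> (\<Sum>s\<in>{1..int n}. C / (a * real n) powr p)"
      by (intro sum_mono single)
    also have "\<dots> = C / a powr p * real n powr (1 - p)"
      using a n by (simp add: powr_mult powr_diff field_simps)
    finally show ?thesis .
  qed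
  have "(\<lambda>n. real n powr (1 - p)) \<longlonglongrightarrow> 0"
    using p by (intro tendsto_neg_powr filterlim_real_sequentially) auto
  then have "(\<lambda>n. C / a powr p * real n powr (1 - p)) \<longlonglongrightarrow> 0"
    by (rule tendsto_mult_right_zero)
  then show ?thesis
    by (rule tendsto_sandwich[rotated 2, OF tendsto_const])
       (simp, rule eventually_mono[OF eventually_gt_at_top[of 0]], rule le)
qed

section \<open>Unreasonable order\<close>

theorem theorem8p4:
  fixes M :: "'a measure"
    and X \<delta> \<epsilon> Y :: "int \<Rightarrow> 'a \<Rightarrow> real"
    and h\<^sub>0 :: "real \<Rightarrow> real"
    and p :: real
  assumes "prob_space M"
    and "\<And>t. X t \<in> borel_measurable M"
    and "\<And>t. \<delta> t \<in> borel_measurable M"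
    and "\<And>t. \<epsilon> t \<in> borel_measurable M"
    and "\<And>t. continuous_on UNIV (cdf (distr M borel (X t)))"
    and "AE \<omega> in M. \<forall>s t. s \<noteq> t \<longrightarrow> X s \<omega> \<noteq> X t \<omega>"
    and "\<And>t \<omega>. \<omega> \<in> space M \<Longrightarrow> Y t \<omega> = h\<^sub>0 (X t \<omega> + \<delta> t \<omega>) + \<epsilon> t \<omega>"
    and "\<exists>L. L-lipschitz_on UNIV h\<^sub>0"
    and "strictly_stationary M X"
    and "alpha_mixing M X"
    and "p > 1"
    and "\<And>t. integrable M (\<lambda>\<omega>. \<bar>X t \<omega>\<bar> powr p)"
    and "iid M \<delta>"
    and "iid M \<epsilon>"
    and "indep_sequences M X \<delta> \<epsilon>"
    and "(\<integral>\<^sup>+\<omega>. ennreal \<bar>h\<^sub>0 (X 1 \<omega> + \<delta> 2 \<omega>) + \<epsilon> 2 \<omega> - h\<^sub>0 (X 1 \<omega> + \<delta> 1 \<omega>) - \<epsilon> 1 \<omega>\<bar> \<partial>M) > 0"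
  shows "out_of_reasonable_order M p X Y"
proof -
  interpret prob_space M by fact
  note [measurable] = assms(2-4)
  obtain L where lip: "L-lipschitz_on UNIV h\<^sub>0" using assms(8) by blast
  then have L: "0 \<le> L" by (rule lipschitz_on_nonneg)
  have [measurable]: "h\<^sub>0 \<in> borel_measurable borel"
    using lipschitz_on_continuous_on[OF lip] by (rule borel_measurable_continuous_onI)
  \<comment> \<open>Pairing makes each output a function of its own input and one entry of a single
    iid sequence.\<close>
  define W where "W = (\<lambda>t \<omega>. (\<delta> t \<omega>, \<epsilon> t \<omega>))"
  have indW: "indep_vars (\<lambda>_. borel) W UNIV"
    unfolding W_def by (rule indep_vars_anomaly_pairs) fact+
  have W[measurable]: "W t \<in> borel_measurable M" for t
    using indW by (simp add: indep_vars_def2)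
  let ?PX = "PiM UNIV (\<lambda>_::int. borel :: real measure)"
  let ?PW = "PiM UNIV (\<lambda>_::int. borel :: (real \<times> real) measure)"
  have Xs[measurable]: "(\<lambda>\<omega> t. X t \<omega>) \<in> measurable M ?PX"
    and Ws[measurable]: "(\<lambda>\<omega> t. W t \<omega>) \<in> measurable M ?PW"
    by (auto intro!: measurable_PiM_single')
  have law: "distr M (?PX \<Otimes>\<^sub>M ?PW) (\<lambda>\<omega>. (\<lambda>t. X t \<omega>, \<lambda>t. W t \<omega>))
      = distr M ?PX (\<lambda>\<omega> t. X t \<omega>) \<Otimes>\<^sub>M distr M ?PW (\<lambda>\<omega> t. W t \<omega>)"
    unfolding W_def by (rule distr_inputs_anomaly_pairs) fact+
  have idW: "distr M borel (W i) = distr M borel (W j)" for i j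
  proof -
    have *: "distr M (borel \<Otimes>\<^sub>M borel) (W i) = distr M borel (\<delta> i) \<Otimes>\<^sub>M distr M borel (\<epsilon> i)" for i
      unfolding W_def by (rule distr_anomaly_pair) fact+
    have "distr M (borel \<Otimes>\<^sub>M borel) (W i) = distr M (borel \<Otimes>\<^sub>M borel) (W j)"
      unfolding * using assms(13,14) unfolding iid_def by metis
    then show ?thesis by (simp add: borel_prod)
  qed
  define g where "g = (\<lambda>x. expectation (\<lambda>\<omega>. anomaly_gap h\<^sub>0 x (W 2 \<omega>) (W 1 \<omega>)))"
  have int_gap: "integrable M (\<lambda>\<omega>. anomaly_gap h\<^sub>0 x (W i \<omega>) (W j \<omega>))" for x i j
    using anomaly_gap_bounds by (intro integrable_const_bound[where B = 1]) auto
  have g: "0 \<le> g x" "g x \<le> 1" for x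
    unfolding g_def using anomaly_gap_bounds int_gap
    by (auto intro!: integral_nonneg_AE integral_le_const AE_I2 simp: anomaly_gap_bounds)
  have [measurable]: "g \<in> borel_measurable borel"
    unfolding g_def by measurable
  define q where "q c = prob {\<omega> \<in> space M. X 1 \<omega> \<in> {x. c \<le> g x}}" for c
  \<comment> \<open>Otherwise \<open>g (X 1)\<close> vanishes almost surely. Integrating over the
    independent inputs, the truncated gap at \<open>X 1\<close> vanishes almost surely as well,
    against condition (ii).\<close>
  have "\<exists>c>0. 0 < q c"
  proof (rule ccontr)
    assume "\<not> ?thesis"
    then have q0: "q (1 / real (Suc k)) = 0" for k
      using measure_nonneg[of M] unfolding q_def by (meson antisym not_le of_nat_0_less_iff zero_less_Suc zero_less_divide_1_iff)
    have "AE \<omega> in M. g (X 1 \<omega>) < 1 / real (Suc k)" for k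
      using q0[of k] unfolding q_def by (subst AE_iff_measurable[OF _ refl]) (auto simp: emeasure_eq_measure not_less)
    then have "AE \<omega> in M. \<forall>k. g (X 1 \<omega>) < 1 / real (Suc k)"
      unfolding AE_all_countable by blast
    then have g0: "AE \<omega> in M. g (X 1 \<omega>) = 0"
    proof (rule AE_mp, intro AE_I2 impI)
      fix \<omega> assume *: "\<forall>k. g (X 1 \<omega>) < 1 / real (Suc k)"
      show "g (X 1 \<omega>) = 0"
      proof (rule ccontr)
        assume "g (X 1 \<omega>) \<noteq> 0"
        then have "0 < g (X 1 \<omega>)" using g(1)[of "X 1 \<omega>"] by linarith
        then show False using nat_approx_posE * by (metis less_asym)
      qed
    qed
    have "(\<integral>\<^sup>+\<omega>. ennreal (anomaly_gap h\<^sub>0 (X 1 \<omega>) (W 2 \<omega>) (W 1 \<omega>)) \<partial>M)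
        = (\<integral>\<^sup>+\<omega>. \<integral>\<^sup>+\<omega>'. ennreal (anomaly_gap h\<^sub>0 (X 1 \<omega>) (W 2 \<omega>') (W 1 \<omega>')) \<partial>M \<partial>M)"
      using nn_integral_indep_var[OF Xs Ws law, of "\<lambda>(x, w). ennreal (anomaly_gap h\<^sub>0 (x 1) (w 2) (w 1))"]
      by simp
    also have "\<dots> = (\<integral>\<^sup>+\<omega>. ennreal (g (X 1 \<omega>)) \<partial>M)"
      unfolding g_def using anomaly_gap_bounds by (simp add: nn_integral_eq_integral int_gap)
    also have "\<dots> = 0"
      using g0 by (subst nn_integral_0_iff_AE) auto
    finally have "AE \<omega> in M. ennreal (anomaly_gap h\<^sub>0 (X 1 \<omega>) (W 2 \<omega>) (W 1 \<omega>)) = 0"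
      by (subst (asm) nn_integral_0_iff_AE) auto
    \<comment> \<open>Truncation at 1 does not change where the difference is zero.\<close>
    then have "AE \<omega> in M. ennreal \<bar>h\<^sub>0 (X 1 \<omega> + \<delta> 2 \<omega>) + \<epsilon> 2 \<omega> - h\<^sub>0 (X 1 \<omega> + \<delta> 1 \<omega>) - \<epsilon> 1 \<omega>\<bar> = 0"
      by (rule AE_mp) (auto intro!: AE_I2 simp: W_def anomaly_gap_def ennreal_eq_0_iff min_def split: if_splits)
    then have "(\<integral>\<^sup>+\<omega>. ennreal \<bar>h\<^sub>0 (X 1 \<omega> + \<delta> 2 \<omega>) + \<epsilon> 2 \<omega> - h\<^sub>0 (X 1 \<omega> + \<delta> 1 \<omega>) - \<epsilon> 1 \<omega>\<bar> \<partial>M) = 0"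
      by (subst nn_integral_0_iff_AE) auto
    then show False using assms(16) by simp
  qed
  then obtain c where c: "0 < c" "0 < q c" by blast
  \<comment> \<open>Half of \<open>\<kappa> * n\<close> is the growth secured by the frequency
    bound. The choice of \<open>\<eta>\<close> keeps the Lipschitz error below an eighth of
    \<open>\<kappa> * n\<close>; \<open>L + 1\<close> avoids division by zero.\<close>
  define \<kappa> where "\<kappa> = c * q c"
  define \<eta> where "\<eta> = \<kappa> / 16 / (L + 1)"
  have \<kappa>: "0 < \<kappa>" using c by (simp add: \<kappa>_def)
  then have \<eta>: "0 < \<eta>" using L by (simp add: \<eta>_def)
  have L\<eta>: "2 * L * \<eta> \<le> \<kappa> / 8"
  proof -
    have "(L + 1) * \<eta> = \<kappa> / 16"
      using L nonzero_mult_div_cancel_left[of "L + 1" "\<kappa> / 16"] unfolding \<eta>_def times_divide_eq_right by linarith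
    moreover have "2 * L * \<eta> \<le> 2 * ((L + 1) * \<eta>)" using \<eta> by (simp add: algebra_simps)
    ultimately show ?thesis by linarith
  qed
  define dev where "dev n \<sigma> x w = \<bar>\<Sum>t = 2..n. anomaly_gap h\<^sub>0 (x (\<sigma> (t - 1))) (w (\<sigma> t)) (w (\<sigma> (t - 1)))
      - g (x (\<sigma> (t - 1)))\<bar>" for n :: nat and \<sigma> and x :: "int \<Rightarrow> real" and w :: "int \<Rightarrow> real \<times> real"
  \<comment> \<open>Living on the space of sequences, this event has sections at frozen inputs.
    Quantifying over the finitely many candidate permutations makes it measurable.\<close>
  define H where "H n = {z \<in> space (?PX \<Otimes>\<^sub>M ?PW). \<exists>\<sigma>\<in>{1..n} \<rightarrow>\<^sub>E {1..int n}.
      arranges \<sigma> (fst z) n \<and> \<kappa> / 4 * real n \<le> dev n \<sigma> (fst z) (snd z)}" for n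
  have H[measurable]: "H n \<in> sets (?PX \<Otimes>\<^sub>M ?PW)" for n
  proof -
    have [measurable]: "(\<lambda>z. fst z i) \<in> borel_measurable (?PX \<Otimes>\<^sub>M ?PW)"
      "(\<lambda>z. snd z i) \<in> borel_measurable (?PX \<Otimes>\<^sub>M ?PW)" for i
      by (auto intro: measurable_compose[OF measurable_fst] measurable_compose[OF measurable_snd])
    show ?thesis
      unfolding H_def dev_def arranges_def
      by (intro sets.sets_Collect_finite_Ex) (simp_all add: finite_PiE, measurable)
  qed
  \<comment> \<open>The three exceptional events: an input is too large, too few inputs may fall
    where \<open>g\<close> is at least \<open>c\<close>, or the anomalies deviate from their
    conditional mean.\<close>
  define E1 where "E1 n = {\<omega> \<in> space M. \<exists>s\<in>{1..int n}. \<eta> * real n < \<bar>X s \<omega>\<bar>}" for n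
  define E2 where "E2 n = {\<omega> \<in> space M. q c / 2 * real n \<le> \<bar>\<Sum>s = 1..int n. indicator {x. c \<le> g x} (X s \<omega>) - q c\<bar>}" for n
  define E3 where "E3 n = {\<omega> \<in> space M. (\<lambda>t. X t \<omega>, \<lambda>t. W t \<omega>) \<in> H n}" for n
  have [measurable]: "E1 n \<in> sets M" "E2 n \<in> sets M" "E3 n \<in> sets M" for n
    unfolding E1_def E2_def E3_def by measurable
  have E1: "(\<lambda>n. prob (E1 n)) \<longlonglongrightarrow> 0"
    unfolding E1_def using assms \<eta> by (intro stationary_max_tendsto[where p = p]) auto
  have E2: "(\<lambda>n. prob (E2 n)) \<longlonglongrightarrow> 0"
    unfolding E2_def q_def using assms c by (intro alpha_mixing_frequency_tendsto) (auto simp: q_def)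
  \<comment> \<open>The 48 is 3 times the square of 4, from the 1-dependent bound at threshold
    \<open>\<kappa> / 4 * n\<close>.\<close>
  have E3_le: "prob (E3 n) \<le> 48 / \<kappa>\<^sup>2 / real n" if n: "0 < n" for n
    unfolding E3_def
  proof (rule prob_indep_var_le[OF Xs Ws law H])
    fix x :: "int \<Rightarrow> real"
    show "prob {\<omega> \<in> space M. (x, \<lambda>t. W t \<omega>) \<in> H n} \<le> 48 / \<kappa>\<^sup>2 / real n"
    \<comment> \<open>For frozen inputs the section is empty or, by uniqueness of the arrangement,
      concerns one nonrandom permutation.\<close>
    proof (cases "\<exists>\<sigma>. arranges \<sigma> x n")
      case True
      then obtain \<sigma> where \<sigma>: "arranges \<sigma> x n" by blast
      have "prob {\<omega> \<in> space M. (x, \<lambda>t. W t \<omega>) \<in> H n} \<le> prob {\<omega> \<in> space M. \<kappa> / 4 * real n \<le> dev n \<sigma> x (\<lambda>t. W t \<omega>)}"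
        unfolding dev_def
        by (intro finite_measure_mono) (auto simp: H_def dev_def dest: arranges_unique[OF \<sigma>])
      also have "\<dots> \<le> 3 * real n / (\<kappa> / 4 * real n)\<^sup>2"
        using prob_neighbour_sum_deviation_le[OF indW idW arranges_inj_on[OF \<sigma>],
            of "\<lambda>t z. anomaly_gap h\<^sub>0 (x (\<sigma> (t - 1))) (fst z) (snd z)" "\<kappa> / 4 * real n"]
          anomaly_gap_bounds \<kappa> n
        by (simp add: dev_def g_def)
      also have "\<dots> = 48 / \<kappa>\<^sup>2 / real n"
        using n \<kappa> by (simp add: power2_eq_square field_simps)
      finally show ?thesis .
    next
      case False
      then have empty: "{\<omega> \<in> space M. (x, \<lambda>t. W t \<omega>) \<in> H n} = {}" by (auto simp: H_def)
      show ?thesis unfolding empty by simp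
    qed
  qed simp
  have "(\<lambda>n. 48 / \<kappa>\<^sup>2 / real n) \<longlonglongrightarrow> 0" by (rule lim_const_over_n)
  then have E3: "(\<lambda>n. prob (E3 n)) \<longlonglongrightarrow> 0"
    by (rule tendsto_sandwich[rotated 2, OF tendsto_const])
       (simp, rule eventually_mono[OF eventually_gt_at_top[of 0]], rule E3_le)
  show ?thesis
    unfolding out_of_reasonable_order_def
  proof
    fix b :: real
    let ?Q = "\<lambda>n. {\<omega> \<in> space M. B_stat p (\<lambda>s. X s \<omega>) (\<lambda>s. Y s \<omega>) n \<le> b}"
    \<comment> \<open>The error from \<open>b\<close> and the boundary term, divided by
      \<open>n\<close>; the exponent \<open>1 / p - 1\<close> is negative.\<close>
    have "(\<lambda>n::nat. \<bar>b\<bar> * real n powr (1 / p - 1) + 1 / real n) \<longlonglongrightarrow> \<bar>b\<bar> * 0 + 0"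
      using assms(11)
      by (intro tendsto_add tendsto_mult tendsto_const lim_const_over_n tendsto_neg_powr filterlim_real_sequentially) auto
    then have "\<forall>\<^sub>F n in sequentially. \<bar>b\<bar> * real n powr (1 / p - 1) + 1 / real n < \<kappa> / 8"
      using \<kappa> by (intro order_tendstoD(2)) auto
    then have small: "\<forall>\<^sub>F n in sequentially. 0 < n \<and> 1 + \<bar>b\<bar> * real n powr (1 / p) \<le> \<kappa> / 8 * real n"
      using eventually_gt_at_top[of "0::nat"]
    proof eventually_elim
      case (elim n)
      then have "(\<bar>b\<bar> * real n powr (1 / p - 1) + 1 / real n) * real n \<le> \<kappa> / 8 * real n"
        by (intro mult_right_mono) auto
      then show ?case using elim by (simp add: powr_diff field_simps)
    qed
    have le: "\<forall>\<^sub>F n in sequentially. prob (?Q n) \<le> prob (E1 n) + prob (E2 n) + prob (E3 n)"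
      using small
    proof eventually_elim
      case (elim n)
      \<comment> \<open>The inclusion is only almost sure because an arrangement is obtained from
        distinct inputs.\<close>
      have cover: "AE \<omega> in M. \<omega> \<in> ?Q n \<longrightarrow> \<omega> \<in> E1 n \<union> E2 n \<union> E3 n"
        using assms(6)
      proof (rule AE_mp, intro AE_I2 impI)
        fix \<omega> assume \<omega>: "\<omega> \<in> space M" and distinct: "\<forall>s t. s \<noteq> t \<longrightarrow> X s \<omega> \<noteq> X t \<omega>" and Q: "\<omega> \<in> ?Q n"
        show "\<omega> \<in> E1 n \<union> E2 n \<union> E3 n"
        proof (rule ccontr)
          assume not: "\<omega> \<notin> E1 n \<union> E2 n \<union> E3 n"
          have "inj_on (\<lambda>s. X s \<omega>) {1..int n}" using distinct by (auto intro: inj_onI)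
          then obtain \<sigma> where \<sigma>: "arranges \<sigma> (\<lambda>s. X s \<omega>) n" using arranges_exists by blast
          have bound: "\<bar>X s \<omega>\<bar> \<le> \<eta> * real n" if "s \<in> {1..int n}" for s
            using not \<omega> that by (force simp: E1_def not_less)
          have "\<bar>(\<Sum>s = 1..int n. indicator {x. c \<le> g x} (X s \<omega>)) - real n * q c\<bar> < q c / 2 * real n"
            using not \<omega> by (simp add: E2_def sum_subtractf not_le)
          then have freq: "q c / 2 * real n \<le> (\<Sum>s = 1..int n. indicator {x. c \<le> g x} (X s \<omega>))"
            by (simp only: abs_less_iff) (simp add: field_simps)
          \<comment> \<open>Of the growth \<open>\<kappa> / 2 * n\<close>, one eighth of
            \<open>\<kappa> * n\<close> pays for the Lipschitz error and another for
            \<open>b\<close> and the boundary term. The remaining quarter is the threshold in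
            \<open>H\<close>.\<close>
          have "c * (q c / 2 * real n) - 1 - \<bar>b\<bar> * real n powr (1 / p) - 2 * L * (\<eta> * real n)
              \<le> dev n \<sigma> (\<lambda>s. X s \<omega>) (\<lambda>s. W s \<omega>)"
            unfolding dev_def
            using Q \<omega> elim c g assms(7)
            by (intro sum_anomaly_gap_deviation[OF \<sigma> lip bound, where y = "\<lambda>s. Y s \<omega>"] freq) (auto simp: W_def)
          moreover have "2 * L * (\<eta> * real n) \<le> \<kappa> / 8 * real n"
            using mult_right_mono[OF L\<eta>, of "real n"] by (simp add: mult.assoc)
          moreover have "c * (q c / 2 * real n) = \<kappa> / 2 * real n" by (simp add: \<kappa>_def)
          ultimately have "\<kappa> / 4 * real n \<le> dev n \<sigma> (\<lambda>s. X s \<omega>) (\<lambda>s. W s \<omega>)"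
            using elim by linarith
          then have "\<omega> \<in> E3 n"
            using \<sigma> \<omega> by (auto simp: E3_def H_def space_pair_measure space_PiM arranges_def)
          then show False using not by simp
        qed
      qed
      show ?case
      \<comment> \<open>A set that is not an event has measure 0 by convention.\<close>
      proof (cases "?Q n \<in> sets M")
        case True
        have "prob (?Q n) \<le> prob (E1 n \<union> E2 n \<union> E3 n)"
          using cover by (intro finite_measure_mono_AE) auto
        also have "\<dots> \<le> prob (E1 n) + prob (E2 n) + prob (E3 n)"
          by (intro order_trans[OF measure_Un_le] add_mono order_refl) auto
        finally show ?thesis .
      next
        case False
        then show ?thesis by (simp add: measure_notin_sets)
      qed
    qed
    have "(\<lambda>n. prob (E1 n) + prob (E2 n) + prob (E3 n)) \<longlonglongrightarrow> 0"
      using tendsto_add[OF tendsto_add[OF E1 E2] E3] by simp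
    then show "(\<lambda>n. prob (?Q n)) \<longlonglongrightarrow> 0"
      by (rule tendsto_sandwich[OF always_eventually le tendsto_const, rotated]) (simp add: measure_nonneg)
  qed
qed

end
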